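(* Let $n\ge 3$ and let $R_3$ be the $(n+2)$-dimensional complex solvable Leibniz algebra with basis $\{e_1,\dots,e_n,x,y\}$ and multiplication $$[e_1,e_1]=e_3,\quad [e_i,e_1]=e_{i+1}\ (3\le i\le n-1),\quad [e_1,x]=e_1,\quad [x,e_1]=-e_1,$$ $$[e_i,x]=(i-1)e_i\ (3\le i\le n),\quad [e_2,y]=e_2,$$ all other products of basis elements being zero. A linear map $\varphi:R_3\to R_3$ is an automorphism of $R_3$ if and only if there exist $\alpha,\beta,\gamma\in\mathbb{C}$ with $\alpha\gamma\neq 0$ such that $$\varphi(e_1)=\alpha e_1+\sum_{i=3}^n\frac{(-1)^i\alpha\beta^{i-2}}{(i-2)!}\,e_i,\qquad \varphi(e_2)=\gamma e_2,$$ $$\varphi(e_i)=\sum_{j=i}^n\frac{(-1)^{j-i}\alpha^{i-1}\beta^{j-i}}{(j-i)!}\,e_j\ \ (3\le i\le n),$$ $$\varphi(x)=\beta e_1+\sum_{i=3}^n\frac{(-1)^i\beta^{i-1}}{(i-1)!}\,e_i+x,\qquad \varphi(y)=y.$$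
   Context: All algebras are over $\mathbb{C}$. A Leibniz algebra is a vector space $L$ with a bilinear product $[-,-]$ satisfying $[[x,y],z]=[[x,z],y]+[x,[y,z]]$ for all $x,y,z\in L$ (the product need not be antisymmetric). In multiplication tables, products of basis elements that are not listed are zero. An automorphism of $L$ is a bijective linear map $\varphi:L\to L$ with $\varphi([u,v])=[\varphi(u),\varphi(v)]$ for all $u,v\in L$. Convention: $t^0=1$ for every $t\in\mathbb{C}$, including $t=0$. *)

theory Defs
  imports "HOL-Analysis.Cartesian_Space"
begin

text \<open>Following the convention of \<^locale>\<open>vector_space\<close>, the underlying complex vector space is
  a type together with a scalar multiplication.\<close>

locale leibniz_algebra = vector_space smul
  for smul :: "complex \<Rightarrow> 'v::ab_group_add \<Rightarrow> 'v" +
  fixes br :: "'v \<Rightarrow> 'v \<Rightarrow> 'v"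
  assumes linear_left: "Vector_Spaces.linear smul smul (\<lambda>u. br u v)"
    and linear_right: "Vector_Spaces.linear smul smul (br u)"
    and leibniz: "br (br u v) w = br (br u w) v + br u (br v w)"

definition leibniz_automorphism ::
  "(complex \<Rightarrow> 'v::ab_group_add \<Rightarrow> 'v) \<Rightarrow> ('v \<Rightarrow> 'v \<Rightarrow> 'v) \<Rightarrow> ('v \<Rightarrow> 'v) \<Rightarrow> bool" where
  "leibniz_automorphism smul br \<phi> \<longleftrightarrow>
     Vector_Spaces.linear smul smul \<phi> \<and> bij \<phi> \<and> (\<forall>u v. \<phi> (br u v) = br (\<phi> u) (\<phi> v))"

text \<open>Only the values of \<open>e\<close> on \<open>{1..n}\<close> matter, and \<open>n \<ge> 3\<close> is intended. The cardinality
  assumption says that \<open>e 1, \<dots>, e n, x, y\<close> are pairwise distinct.\<close>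

locale R3_algebra = leibniz_algebra smul br
  for smul :: "complex \<Rightarrow> 'v::ab_group_add \<Rightarrow> 'v" and br :: "'v \<Rightarrow> 'v \<Rightarrow> 'v" +
  fixes n :: nat and e :: "nat \<Rightarrow> 'v" and x y :: 'v
  assumes basis_card: "card (e ` {1..n} \<union> {x, y}) = n + 2"
    and basis_independent: "independent (e ` {1..n} \<union> {x, y})"
    and basis_span: "span (e ` {1..n} \<union> {x, y}) = UNIV"
    and e_e: "\<lbrakk>i \<in> {1..n}; j \<in> {1..n}\<rbrakk> \<Longrightarrow> br (e i) (e j) =
      (if i = 1 \<and> j = 1 then e 3
       else if 3 \<le> i \<and> i \<le> n - 1 \<and> j = 1 then e (i + 1)
       else 0)"
    and e_x: "i \<in> {1..n} \<Longrightarrow> br (e i) x =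
      (if i = 1 then e 1
       else if 3 \<le> i then smul (of_nat (i - 1)) (e i)
       else 0)"
    and x_e: "j \<in> {1..n} \<Longrightarrow> br x (e j) = (if j = 1 then - e 1 else 0)"
    and e_y: "i \<in> {1..n} \<Longrightarrow> br (e i) y = (if i = 2 then e 2 else 0)"
    and y_e: "j \<in> {1..n} \<Longrightarrow> br y (e j) = 0"
    and x_x: "br x x = 0" and x_y: "br x y = 0" and y_x: "br y x = 0" and y_y: "br y y = 0"

text \<open>The assumptions are satisfiable: every coordinate space of dimension \<open>n + 2\<close> carries
  such an algebra structure.\<close>

lemma R3_algebra_exists:
  assumes n: "3 \<le> n" and card: "CARD('k::finite) = n + 2"
  shows "\<exists>br e x y. R3_algebra ((*s) :: complex \<Rightarrow> complex^'k \<Rightarrow> complex^'k) br n e x y"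
proof -
  have "card {1..n+2} = card (UNIV :: 'k set)" using card by simp
  then obtain g :: "nat \<Rightarrow> 'k" where g: "bij_betw g {1..n+2} UNIV"
    using finite_same_card_bij[of "{1..n+2}" "UNIV :: 'k set"] by auto
  define h where "h = the_inv_into {1..n+2} g"
  have hg: "h (g m) = m" if "1 \<le> m" "m \<le> n + 2" for m
    unfolding h_def using g that by (auto simp: bij_betw_def the_inv_into_f_f)
  have hr: "1 \<le> h k \<and> h k \<le> n + 2" for k
    unfolding h_def using bij_betw_the_inv_into[OF g] by (auto simp: bij_betw_def)
  have gh: "g (h k) = k" for k
    unfolding h_def using f_the_inv_into_f_bij_betw[OF g] by blast
  define br :: "complex^'k \<Rightarrow> complex^'k \<Rightarrow> complex^'k" where
    "br u v = (\<chi> k. let m = h k in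
       if m = 1 then u $ g 1 * v $ g (n+1) - u $ g (n+1) * v $ g 1
       else if m = 2 then u $ g 2 * v $ g (n+2)
       else if m = 3 then u $ g 1 * v $ g 1 + 2 * u $ g 3 * v $ g (n+1)
       else if m \<le> n then u $ g (m-1) * v $ g 1 + of_nat (m-1) * u $ g m * v $ g (n+1)
       else 0)" for u v
  define b :: "nat \<Rightarrow> complex^'k" where "b i = (\<chi> k. if h k = i then 1 else 0)" for i
  have bg: "b i $ g m = (if m = i then 1 else 0)" if "1 \<le> m" "m \<le> n + 2" for i m
    using that by (simp add: b_def hg)
  have bp: "b i $ g (h k - Suc 0) = (if h k = Suc i then 1 else 0)" if "h k \<noteq> Suc 0" for i k
    using that hr[of k] bg[of "h k - 1" i] by auto
  have bh: "b i $ g (h k) = (if h k = i then 1 else 0)" for i k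
    by (simp add: b_def gh)
  have lin1: "Vector_Spaces.linear (*s) (*s) (\<lambda>u. br u v)" for v
    by unfold_locales (auto simp: br_def vec_eq_iff Let_def algebra_simps)
  have lin2: "Vector_Spaces.linear (*s) (*s) (br u)" for u
    by unfold_locales (auto simp: br_def vec_eq_iff Let_def algebra_simps)
  have leib: "br (br u v) w = br (br u w) v + br u (br v w)" for u v w
  proof -
    have "br (br u v) w $ g m = (br (br u w) v + br u (br v w)) $ g m"
      if m: "1 \<le> m" "m \<le> n + 2" for m
    proof -
      consider "m = 1" | "m = 2" | "m = 3" | "m = 4" "m \<le> n" | "5 \<le> m" "m \<le> n" | "n < m"
        using m by linarith
      then show ?thesis
      proof cases
        case 5
        then obtain p where p: "m = p + 5" using le_Suc_ex add.commute by metis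
        show ?thesis using 5 n m
          by (simp add: br_def Let_def hg p algebra_simps)
      qed (use n m in \<open>simp_all add: br_def Let_def hg algebra_simps\<close>)
    qed
    then have "br (br u v) w $ k = (br (br u w) v + br u (br v w)) $ k" for k
      using hr[of k] gh[of k] by metis
    then show ?thesis by (simp add: vec_eq_iff)
  qed
  have set_eq: "b ` {1..n} \<union> {b (n+1), b (n+2)} = b ` {1..n+2}"
  proof -
    have "{1..n+2} = {1..n} \<union> {n+1, n+2}" by auto
    then show ?thesis by (simp add: image_Un)
  qed
  have inj: "inj_on b {1..n+2}"
  proof (rule inj_onI)
    fix i j assume "i \<in> {1..n+2}" "j \<in> {1..n+2}" "b i = b j"
    then show "i = j" using bg[of i i] bg[of i j] by (auto split: if_splits)
  qed
  have b_axis: "b (h k) = axis k 1" for k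
    unfolding b_def axis_def vec_eq_iff using gh by (auto, metis)
  have img: "b ` {1..n+2} = cart_basis"
  proof -
    have "{1..n+2} = range h"
      using hr hg by (auto simp: image_iff) metis
    then show ?thesis by (auto simp: cart_basis_def b_axis image_image)
  qed
  have "R3_algebra (*s) br n b (b (n+1)) (b (n+2))"
  proof (intro R3_algebra.intro R3_algebra_axioms.intro leibniz_algebra.intro
      leibniz_algebra_axioms.intro lin1 lin2 leib)
    show "vector_space ((*s) :: complex \<Rightarrow> complex^'k \<Rightarrow> complex^'k)"
      by (rule vec.vector_space_axioms)
    show "card (b ` {1..n} \<union> {b (n+1), b (n+2)}) = n + 2"
      unfolding set_eq using card_image[OF inj] by simp
    show "vec.independent (b ` {1..n} \<union> {b (n+1), b (n+2)})"
      unfolding set_eq img by (rule independent_cart_basis)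
    show "vec.span (b ` {1..n} \<union> {b (n+1), b (n+2)}) = UNIV"
      unfolding set_eq img by (rule span_cart_basis)
  next
    fix i j assume ij: "i \<in> {1..n}" "j \<in> {1..n}"
    have ee: "br (b i) (b j) $ k = (let m = h k in
       if m = 3 \<and> i = 1 \<and> j = 1 \<or> 4 \<le> m \<and> m \<le> n \<and> i = m - 1 \<and> j = 1 then 1 else 0)" for k
      using ij n hr[of k] by (auto simp: br_def Let_def bg bp)
    show "br (b i) (b j) = (if i = 1 \<and> j = 1 then b 3
        else if 3 \<le> i \<and> i \<le> n - 1 \<and> j = 1 then b (i + 1) else 0)"
      unfolding vec_eq_iff ee using ij n by (auto simp: b_def Let_def)
  next
    fix i assume i: "i \<in> {1..n}"
    have ex: "br (b i) (b (n+1)) $ k = (let m = h k in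
       if m = i \<and> i = 1 then 1 else if m = i \<and> 3 \<le> i then of_nat (i - 1) else 0)" for k
      using i n hr[of k] by (auto simp: br_def Let_def bg)
    show "br (b i) (b (n+1)) = (if i = 1 then b 1
        else if 3 \<le> i then of_nat (i - 1) *s b i else 0)"
      unfolding vec_eq_iff ex using i n by (auto simp: b_def Let_def)
    show "br (b (n+1)) (b i) = (if i = 1 then - b 1 else 0)"
      using i n by (simp add: vec_eq_iff br_def Let_def bg bp) (auto simp: b_def)
    show "br (b i) (b (n+2)) = (if i = 2 then b 2 else 0)"
      using i n by (simp add: vec_eq_iff br_def Let_def bg bp) (auto simp: b_def)
    show "br (b (n+2)) (b i) = 0"
      using i n by (simp add: vec_eq_iff br_def Let_def bg bp)
  qed (use n in \<open>auto simp: vec_eq_iff br_def Let_def bg bp bh\<close>)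
  then show ?thesis by blast
qed

end

theory Submission imports Defs begin

text \<open>Relabel \<open>e\<^sub>1\<close> as \<open>f\<^sub>2\<close> and put \<open>f\<^sub>i = e\<^sub>i\<close> for \<open>i \<ge> 3\<close>. Right multiplication by \<open>e\<^sub>1\<close> shifts
  \<open>f\<^sub>2 \<mapsto> f\<^sub>3 \<mapsto> \<dots> \<mapsto> f\<^sub>n \<mapsto> 0\<close> and sends \<open>x\<close> to \<open>-f\<^sub>2\<close>, and right multiplication by \<open>x\<close> acts on
  \<open>f\<^sub>i\<close> as \<open>i - 1\<close>, uniformly in \<open>i\<close>. The maps of the theorem are the products of
  \<open>exp (-\<beta> R)\<close>, with \<open>R\<close> the derivation \<open>u \<mapsto> [u, e\<^sub>1]\<close>, and of a diagonal automorphism; they are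
  triangular in the basis \<open>f\<^sub>2, \<dots>, f\<^sub>n\<close>. Conversely, comparing coordinates in the images of the relations
  \<open>[e\<^sub>1, x] = e\<^sub>1\<close>, \<open>[x, x] = 0\<close>, \<open>[e\<^sub>2, y] = e\<^sub>2\<close> and their analogues gives two-term recursions that
  determine all coefficients from \<open>\<alpha>\<close>, \<open>\<beta>\<close>, \<open>\<gamma>\<close>.\<close>

section \<open>Exponential coefficients and extension of bilinear identities\<close>

definition exp_coeff :: "complex \<Rightarrow> nat \<Rightarrow> complex" where
  "exp_coeff \<beta> k = (- \<beta>) ^ k / fact k"

lemma exp_coeff_0: "exp_coeff \<beta> 0 = 1"
  by (simp add: exp_coeff_def)

text \<open>This recursion drives both directions: bracketing with the image of \<open>x\<close>
  produces \<open>\<beta>\<close> times one coordinate plus a multiple of the next, and these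
  coefficients solve the resulting equations.\<close>

lemma exp_coeff_Suc: "\<beta> * exp_coeff \<beta> k = - (of_nat (Suc k) * exp_coeff \<beta> (Suc k))"
  by (simp add: exp_coeff_def field_simps del: of_nat_Suc)

text \<open>Linear maps agreeing on a spanning set are equal; this is applied to the second argument
  with the first one in \<open>S\<close>, and then to the first argument.\<close>

lemma (in vector_space) bilinear_ext:
  assumes "vector_space t"
    and "\<And>v. Vector_Spaces.linear scale t (\<lambda>u. F u v)" "\<And>u. Vector_Spaces.linear scale t (F u)"
    and "\<And>v. Vector_Spaces.linear scale t (\<lambda>u. G u v)" "\<And>u. Vector_Spaces.linear scale t (G u)"
    and "span S = UNIV" "\<And>b c. b \<in> S \<Longrightarrow> c \<in> S \<Longrightarrow> F b c = G b c"
  shows "F u v = G u v"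
proof -
  interpret vector_space_pair scale t
    using assms(1) vector_space_axioms by (simp add: vector_space_pair_def)
  have "F b w = G b w" if "b \<in> S" for b w
    by (rule linear_eq_on_span[where B = S, OF assms(3) assms(5) assms(7)[OF that]])
      (simp_all add: assms(6))
  then show ?thesis
    by (rule linear_eq_on_span[where B = S, OF assms(2) assms(4)]) (simp_all add: assms(6))
qed

section \<open>The basis \<open>chain\<close> and its coordinate functionals\<close>

locale R3_algebra_ge_3 = R3_algebra +
  assumes n_ge_3: "3 \<le> n"
begin

text \<open>The dual basis, indexed by the basis vectors themselves so that the \<open>e i\<close>,
  \<open>x\<close> and \<open>y\<close> are handled alike.\<close>

definition coord :: "'a \<Rightarrow> 'a \<Rightarrow> complex" where
  "coord b v = representation (e ` {1..n} \<union> {x, y}) v b"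

text \<open>The image of \<open>{1..n}\<close> has at most \<open>n\<close> elements, so a total of
  \<open>n + 2\<close> requires \<open>x\<close> and \<open>y\<close> to be new and different, and
  then the \<open>n\<close> images to be distinct.\<close>

lemma basis_distinct:
  shows inj_e: "inj_on e {1..n}" and x_notin: "x \<notin> e ` {1..n}" and y_notin: "y \<notin> e ` {1..n}"
    and x_neq_y: "x \<noteq> y"
proof -
  have le: "card (e ` {1..n}) \<le> n" using card_image_le[of "{1..n}" e] by simp
  have c: "card (insert x (insert y (e ` {1..n}))) = n + 2" using basis_card by simp
  show "x \<notin> e ` {1..n}" "y \<notin> e ` {1..n}" "x \<noteq> y" using c le by (auto simp: card_insert_if split: if_splits)
  then have "card (e ` {1..n}) = n" using c by (simp add: card_insert_if)
  then show "inj_on e {1..n}" by (intro eq_card_imp_inj_on) auto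
qed

definition chain :: "nat \<Rightarrow> 'a" where
  "chain i = (if i = 2 then e 1 else e i)"

lemma chain_basis: "chain ` {2..n} \<union> {e 2, x, y} = e ` {1..n} \<union> {x, y}"
proof -
  have "{1..n} = insert 1 (insert 2 {3..n})" "{2..n} = insert 2 {3..n}" using n_ge_3 by auto
  moreover have "chain ` {3..n} = e ` {3..n}" by (auto simp: chain_def)
  ultimately show ?thesis by (auto simp: chain_def)
qed

lemma coord_add: "coord b (u + v) = coord b u + coord b v"
  unfolding coord_def using basis_span by (subst representation_add[OF basis_independent]) auto

lemma coord_scale: "coord b (smul a v) = a * coord b v"
  unfolding coord_def using basis_span by (subst representation_scale[OF basis_independent]) auto

lemma coord_zero: "coord b 0 = 0"
  by (simp add: coord_def representation_zero)

lemma coord_uminus: "coord b (- v) = - coord b v"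
  unfolding coord_def using basis_span by (subst representation_neg[OF basis_independent]) auto

lemma coord_sum: "coord b (\<Sum>i\<in>I. f i) = (\<Sum>i\<in>I. coord b (f i))"
  by (induction I rule: infinite_finite_induct) (simp_all add: coord_zero coord_add)

lemma coord_basis:
  "\<lbrakk>i \<in> {1..n}; j \<in> {1..n}\<rbrakk> \<Longrightarrow> coord (e i) (e j) = (if i = j then 1 else 0)"
  "i \<in> {1..n} \<Longrightarrow> coord (e i) x = 0" "i \<in> {1..n} \<Longrightarrow> coord (e i) y = 0"
  "j \<in> {1..n} \<Longrightarrow> coord x (e j) = 0" "j \<in> {1..n} \<Longrightarrow> coord y (e j) = 0"
  "coord x x = 1" "coord y y = 1" "coord x y = 0" "coord y x = 0"
proof -
  have rep: "coord b c = (if c = b then 1 else 0)" if "c \<in> e ` {1..n} \<union> {x, y}" for b c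
    unfolding coord_def using representation_basis[OF basis_independent that] by simp
  show "coord (e i) (e j) = (if i = j then 1 else 0)" if "i \<in> {1..n}" "j \<in> {1..n}"
    using that rep[of "e j" "e i"] inj_on_eq_iff[OF inj_e, of j i] by auto
  show "coord (e i) x = 0" "coord (e i) y = 0" if "i \<in> {1..n}"
    using that rep[of x "e i"] rep[of y "e i"] x_notin y_notin by auto
  show "coord x (e j) = 0" "coord y (e j) = 0" if "j \<in> {1..n}"
    using that rep[of "e j" x] rep[of "e j" y] x_notin y_notin by auto
  show "coord x x = 1" "coord y y = 1" "coord x y = 0" "coord y x = 0"
    using rep[of x] rep[of y] x_neq_y by auto
qed

lemma coord_chain:
  "\<lbrakk>i \<in> {2..n}; j \<in> {2..n}\<rbrakk> \<Longrightarrow> coord (chain i) (chain j) = (if i = j then 1 else 0)"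
  "i \<in> {2..n} \<Longrightarrow> coord (chain i) (e 2) = 0" "i \<in> {2..n} \<Longrightarrow> coord (e 2) (chain i) = 0"
  "i \<in> {2..n} \<Longrightarrow> coord (chain i) x = 0" "i \<in> {2..n} \<Longrightarrow> coord (chain i) y = 0"
  "i \<in> {2..n} \<Longrightarrow> coord x (chain i) = 0" "i \<in> {2..n} \<Longrightarrow> coord y (chain i) = 0"
  "coord (e 2) (e 2) = 1" "coord (e 2) x = 0" "coord (e 2) y = 0" "coord x (e 2) = 0" "coord y (e 2) = 0"
  "coord x x = 1" "coord y y = 1" "coord x y = 0" "coord y x = 0"
  using n_ge_3 by (auto simp: chain_def coord_basis)

lemma br_chain:
  "\<lbrakk>i \<in> {2..n}; j \<in> {2..n}\<rbrakk> \<Longrightarrow> br (chain i) (chain j) = (if j = 2 \<and> i < n then chain (Suc i) else 0)"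
  "i \<in> {2..n} \<Longrightarrow> br (chain i) x = smul (of_nat (i - 1)) (chain i)"
  "i \<in> {2..n} \<Longrightarrow> br x (chain i) = (if i = 2 then - chain 2 else 0)"
  "i \<in> {2..n} \<Longrightarrow> br (chain i) y = 0" "i \<in> {2..n} \<Longrightarrow> br y (chain i) = 0"
  "i \<in> {2..n} \<Longrightarrow> br (chain i) (e 2) = 0" "i \<in> {2..n} \<Longrightarrow> br (e 2) (chain i) = 0"
  "br (e 2) (e 2) = 0" "br (e 2) x = 0" "br x (e 2) = 0" "br (e 2) y = e 2" "br y (e 2) = 0"
  "br x x = 0" "br x y = 0" "br y x = 0" "br y y = 0"
  using n_ge_3 by (auto simp: chain_def e_e e_x x_e e_y y_e x_x x_y y_x y_y)

text \<open>The index set is arbitrary because triangular images are partial sums over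
  \<open>{i..n}\<close> with varying \<open>i\<close>.\<close>

lemma coord_lincomb:
  assumes I: "I \<subseteq> {2..n}"
  shows "k \<in> {2..n} \<Longrightarrow> coord (chain k) (\<Sum>i\<in>I. smul (a i) (chain i)) = (if k \<in> I then a k else 0)"
    and "coord (e 2) (\<Sum>i\<in>I. smul (a i) (chain i)) = 0"
    and "coord x (\<Sum>i\<in>I. smul (a i) (chain i)) = 0" "coord y (\<Sum>i\<in>I. smul (a i) (chain i)) = 0"
proof -
  have fin: "finite I" using I finite_subset by blast
  show "coord (chain k) (\<Sum>i\<in>I. smul (a i) (chain i)) = (if k \<in> I then a k else 0)"
    if "k \<in> {2..n}"
  proof -
    have "(\<Sum>i\<in>I. coord (chain k) (smul (a i) (chain i))) = (\<Sum>i\<in>I. if k = i then a i else 0)"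
      using I that by (intro sum.cong refl) (simp add: coord_scale coord_chain subset_iff)
    then show ?thesis using fin by (simp add: coord_sum)
  qed
  have "i \<in> {2..n}" if "i \<in> I" for i using I that by blast
  then show "coord (e 2) (\<Sum>i\<in>I. smul (a i) (chain i)) = 0"
    "coord x (\<Sum>i\<in>I. smul (a i) (chain i)) = 0" "coord y (\<Sum>i\<in>I. smul (a i) (chain i)) = 0"
    by (simp_all add: coord_sum coord_scale coord_chain)
qed

lemma linear_formI:
  assumes "\<And>u v. f (u + v) = f u + f v" "\<And>a u. f (smul a u) = a * f u"
  shows "Vector_Spaces.linear smul ((*) :: complex \<Rightarrow> _) f"
  by (intro Vector_Spaces.linear.intro module_hom.intro module_hom_axioms.intro)
   (unfold_locales; simp add: assms)+

lemma coord_linear: "Vector_Spaces.linear smul (*) (coord b)"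
  by (rule linear_formI) (simp_all add: coord_add coord_scale)

lemma expansion:
  "v = (\<Sum>i=2..n. smul (coord (chain i) v) (chain i)) + smul (coord (e 2) v) (e 2)
     + smul (coord x v) x + smul (coord y v) y"
proof -
  have split: "{1..n} = insert 1 (insert 2 {3..n})" "{2..n} = insert 2 {3..n}"
    using n_ge_3 by auto
  have tail: "(\<Sum>i=3..n. smul (coord (chain i) v) (chain i)) = (\<Sum>i=3..n. smul (coord (e i) v) (e i))"
    by (intro sum.cong) (auto simp: chain_def)
  have "v = (\<Sum>b\<in>e ` {1..n} \<union> {x, y}. smul (coord b v) b)"
    unfolding coord_def
    by (rule sum_representation_eq[OF basis_independent, symmetric]) (use basis_span in auto)
  also have "\<dots> = (\<Sum>b\<in>e ` {1..n}. smul (coord b v) b) + (smul (coord x v) x + smul (coord y v) y)"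
    using basis_distinct by (subst sum.union_disjoint) auto
  also have "(\<Sum>b\<in>e ` {1..n}. smul (coord b v) b) = (\<Sum>i=1..n. smul (coord (e i) v) (e i))"
    using sum.reindex[OF inj_e] by simp
  also have "\<dots> = (\<Sum>i=2..n. smul (coord (chain i) v) (chain i)) + smul (coord (e 2) v) (e 2)"
    unfolding split using tail by (simp add: chain_def ac_simps)
  finally show ?thesis by (simp only: add.assoc)
qed

lemma coord_eqI:
  assumes "\<And>m. m \<in> {2..n} \<Longrightarrow> coord (chain m) u = coord (chain m) v"
    "coord (e 2) u = coord (e 2) v" "coord x u = coord x v" "coord y u = coord y v"
  shows "u = v"
proof -
  let ?E = "\<lambda>v. (\<Sum>i=2..n. smul (coord (chain i) v) (chain i)) + smul (coord (e 2) v) (e 2)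
     + smul (coord x v) x + smul (coord y v) y"
  have "?E u = ?E v"
    unfolding assms(2-4) using assms(1) by (auto intro!: sum.cong)
  then show ?thesis
    \<comment> \<open>The expansion has the bare vector on its left and would loop as a rewrite
      rule, so its two instances are composed by transitivity.\<close>
    by (rule trans[OF expansion[of u] trans[OF _ expansion[of v, symmetric]]])
qed

text \<open>The cases match \<open>coord_br\<close>: no shift reaches \<open>chain 2\<close>, which
  follows its own rule, while every later coordinate relates positions \<open>k\<close> and
  \<open>Suc k\<close>.\<close>

lemma coord_eqI_Suc:
  assumes "coord (chain 2) u = coord (chain 2) v"
    and "\<And>k. \<lbrakk>2 \<le> k; k < n\<rbrakk> \<Longrightarrow> coord (chain (Suc k)) u = coord (chain (Suc k)) v"
    and "coord (e 2) u = coord (e 2) v" "coord x u = coord x v" "coord y u = coord y v"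
  shows "u = v"
proof (rule coord_eqI)
  fix m assume "m \<in> {2..n}"
  then show "coord (chain m) u = coord (chain m) v"
    using assms(1) assms(2)[of "m - 1"] by (cases "m = 2") auto
qed (fact assms)+

section \<open>The multiplication in coordinates\<close>

lemma coord_br_bilinear:
  "Vector_Spaces.linear smul (*) (\<lambda>u. coord b (br u v))"
  "Vector_Spaces.linear smul (*) (\<lambda>v. coord b (br u v))"
  using Vector_Spaces.linear_compose[OF linear_left coord_linear]
    Vector_Spaces.linear_compose[OF linear_right coord_linear] by (simp_all add: o_def)

lemma br_coord_ext:
  assumes "\<And>v. Vector_Spaces.linear smul (*) (\<lambda>u. G u v)" "\<And>u. Vector_Spaces.linear smul (*) (G u)"
    and "\<And>a c. a \<in> chain ` {2..n} \<union> {e 2, x, y} \<Longrightarrow>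
      c \<in> chain ` {2..n} \<union> {e 2, x, y} \<Longrightarrow> coord b (br a c) = G a c"
  shows "coord b (br u v) = G u v"
  by (rule bilinear_ext[OF _ coord_br_bilinear assms(1,2) basis_span assms(3)[unfolded chain_basis]])
    unfold_locales

text \<open>Both sides are bilinear forms, so comparing them on pairs of basis vectors suffices. The
  formulas show that the right factor enters only through its coordinates at \<open>chain 2\<close>,
  \<open>x\<close> and \<open>y\<close>.\<close>

lemma coord_br:
  "coord (chain 2) (br u v) = coord (chain 2) u * coord x v - coord x u * coord (chain 2) v"
    (is "?A1 = ?B1")
  "coord (e 2) (br u v) = coord (e 2) u * coord y v" (is "?A2 = ?B2")
  "2 \<le> k \<Longrightarrow> k < n \<Longrightarrow> coord (chain (Suc k)) (br u v) =
     coord (chain k) u * coord (chain 2) v + of_nat k * coord (chain (Suc k)) u * coord x v"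
    (is "_ \<Longrightarrow> _ \<Longrightarrow> ?A3 = ?B3")
  "coord x (br u v) = 0" "coord y (br u v) = 0"
proof -
  note s = coord_add coord_scale algebra_simps
  note t = coord_chain br_chain coord_zero coord_uminus coord_scale
  show "?A1 = ?B1" by (rule br_coord_ext, (rule linear_formI; simp add: s)+)
      (use n_ge_3 in \<open>auto simp: t\<close>)
  show "?A2 = ?B2" by (rule br_coord_ext, (rule linear_formI; simp add: s)+)
      (use n_ge_3 in \<open>auto simp: t\<close>)
  show "coord x (br u v) = 0" by (rule br_coord_ext, (rule linear_formI; simp add: s)+)
      (use n_ge_3 in \<open>auto simp: t\<close>)
  show "coord y (br u v) = 0" by (rule br_coord_ext, (rule linear_formI; simp add: s)+)
      (use n_ge_3 in \<open>auto simp: t\<close>)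
  show "?A3 = ?B3" if "2 \<le> k" "k < n"
    by (rule br_coord_ext, (rule linear_formI; simp add: s)+)
      (use that in \<open>auto simp: t\<close>)
qed

section \<open>Maps of the stated form are automorphisms\<close>

text \<open>This is \<open>exp (- \<beta> R)\<close> applied after the diagonal map that scales
  \<open>chain i\<close> by \<open>\<alpha> ^ (i - 1)\<close> and \<open>e 2\<close> by
  \<open>\<gamma>\<close> and fixes \<open>x\<close> and \<open>y\<close>. The minus sign in the
  image of \<open>x\<close> comes from \<open>[x, e_1] = -e_1\<close>.\<close>

definition automorphism_form :: "complex \<Rightarrow> complex \<Rightarrow> complex \<Rightarrow> ('a \<Rightarrow> 'a) \<Rightarrow> bool" where
  "automorphism_form \<alpha> \<beta> \<gamma> \<phi> \<longleftrightarrow>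
     (\<forall>i\<in>{2..n}. \<phi> (chain i) = (\<Sum>j=i..n. smul (\<alpha> ^ (i - 1) * exp_coeff \<beta> (j - i)) (chain j))) \<and>
     \<phi> (e 2) = smul \<gamma> (e 2) \<and>
     \<phi> x = (\<Sum>j=2..n. smul (- exp_coeff \<beta> (j - 1)) (chain j)) + x \<and> \<phi> y = y"

lemma automorphism_form_coord:
  assumes "automorphism_form \<alpha> \<beta> \<gamma> \<phi>"
  shows "\<lbrakk>i \<in> {2..n}; m \<in> {2..n}\<rbrakk> \<Longrightarrow> coord (chain m) (\<phi> (chain i)) =
      (if i \<le> m then \<alpha> ^ (i - 1) * exp_coeff \<beta> (m - i) else 0)"
    and "i \<in> {2..n} \<Longrightarrow> coord (e 2) (\<phi> (chain i)) = 0"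
    and "i \<in> {2..n} \<Longrightarrow> coord x (\<phi> (chain i)) = 0"
    and "i \<in> {2..n} \<Longrightarrow> coord y (\<phi> (chain i)) = 0"
    and "m \<in> {2..n} \<Longrightarrow> coord (chain m) (\<phi> (e 2)) = 0"
    and "coord (e 2) (\<phi> (e 2)) = \<gamma>" "coord x (\<phi> (e 2)) = 0" "coord y (\<phi> (e 2)) = 0"
    and "m \<in> {2..n} \<Longrightarrow> coord (chain m) (\<phi> x) = - exp_coeff \<beta> (m - 1)"
    and "coord (e 2) (\<phi> x) = 0" "coord x (\<phi> x) = 1" "coord y (\<phi> x) = 0"
    and "\<phi> y = y"
  \<comment> \<open>Removing \<open>scale_minus_left\<close> keeps the negative coefficients inside
    \<open>smul\<close>, where \<open>coord_lincomb\<close> can match them.\<close>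
  using assms unfolding automorphism_form_def
  by (simp_all add: coord_lincomb coord_add coord_scale coord_chain del: scale_minus_left)

lemma br_right_eq_0:
  assumes "coord (chain 2) v = 0" "coord x v = 0" "coord y v = 0"
  shows "br u v = 0"
  by (rule coord_eqI_Suc) (simp_all add: coord_br coord_zero assms)

text \<open>By bilinearity, basis pairs suffice. On the right, the images of \<open>e 2\<close> and
  of \<open>chain j\<close> with \<open>j \<noteq> 2\<close> annihilate everything, and
  \<open>y\<close> acts as the projection to \<open>e 2\<close>; the substance lies in the right
  factors \<open>chain 2\<close> and \<open>x\<close>.\<close>

lemma automorphism_form_mult:
  assumes lin: "Vector_Spaces.linear smul smul \<phi>" and form: "automorphism_form \<alpha> \<beta> \<gamma> \<phi>"
  shows "\<phi> (br u v) = br (\<phi> u) (\<phi> v)"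
proof -
  interpret phi: Vector_Spaces.linear smul smul \<phi> by (fact lin)
  note c = automorphism_form_coord[OF form]
  note coords = c coord_br coord_zero coord_scale coord_uminus
  have two: "2 \<in> {2..n}" using n_ge_3 by simp
  have E1: "exp_coeff \<beta> 1 = - \<beta>" by (simp add: exp_coeff_def)
  have chain_chain2: "\<phi> (br (chain i) (chain 2)) = br (\<phi> (chain i)) (\<phi> (chain 2))"
    if i: "i \<in> {2..n}" for i
  proof (rule coord_eqI_Suc)
    show "coord (chain 2) (\<phi> (br (chain i) (chain 2))) = coord (chain 2) (br (\<phi> (chain i)) (\<phi> (chain 2)))"
      using i two by (simp add: br_chain phi.zero coords)
  next
    fix k assume k: "2 \<le> k" "k < n"
    show "coord (chain (Suc k)) (\<phi> (br (chain i) (chain 2))) = coord (chain (Suc k)) (br (\<phi> (chain i)) (\<phi> (chain 2)))"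
      using i k two by (cases i) (auto simp: br_chain phi.zero coords exp_coeff_0)
  qed (use i two in \<open>simp_all add: br_chain phi.zero coords\<close>)
  have chain_x: "\<phi> (br (chain i) x) = br (\<phi> (chain i)) (\<phi> x)"
    if i: "i \<in> {2..n}" for i
  proof (rule coord_eqI_Suc)
    show "coord (chain 2) (\<phi> (br (chain i) x)) = coord (chain 2) (br (\<phi> (chain i)) (\<phi> x))"
      using i two by (auto simp: br_chain phi.scale coords)
  next
    fix k assume k: "2 \<le> k" "k < n"
    \<comment> \<open>Position \<open>k + 1\<close> relative to the triangle: before it both sides
      vanish, on the diagonal both carry the eigenvalue \<open>i - 1 = k\<close>, and past it the
      recursion is needed.\<close>
    consider "k + 1 < i" | "i = k + 1" | d where "k = i + d"
      by (metis add.commute le_add_diff_inverse less_eq_Suc_le linorder_neqE_nat linorder_not_le Suc_eq_plus1)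
    then show "coord (chain (Suc k)) (\<phi> (br (chain i) x)) = coord (chain (Suc k)) (br (\<phi> (chain i)) (\<phi> x))"
    proof cases
      case 3
      obtain p where p: "i = Suc p" using i by (cases i) auto
      have "of_nat p * (\<alpha> ^ p * exp_coeff \<beta> (Suc d)) = \<alpha> ^ p * (of_nat p * exp_coeff \<beta> (Suc d))"
        by simp
      \<comment> \<open>Here \<open>k = p + (d + 1)\<close>, so the eigenvalues \<open>p\<close> and
        \<open>k\<close> differ by exactly the factor occurring in
        \<open>exp_coeff_Suc\<close>.\<close>
      also have "of_nat p * exp_coeff \<beta> (Suc d) = \<beta> * exp_coeff \<beta> d + of_nat k * exp_coeff \<beta> (Suc d)"
        unfolding exp_coeff_Suc by (simp add: 3 p algebra_simps)
      finally have "of_nat p * (\<alpha> ^ p * exp_coeff \<beta> (Suc d))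
        = \<alpha> ^ p * exp_coeff \<beta> d * \<beta> + of_nat k * (\<alpha> ^ p * exp_coeff \<beta> (Suc d))"
        by (simp add: algebra_simps)
      then show ?thesis
        using i k two E1 3 p by (simp add: br_chain phi.scale coords Suc_diff_le)
    qed (use i k two in \<open>simp_all add: br_chain phi.scale coords\<close>)
  qed (use i two in \<open>simp_all add: br_chain phi.scale coords\<close>)
  have x_chain2: "\<phi> (br x (chain 2)) = br (\<phi> x) (\<phi> (chain 2))"
  proof (rule coord_eqI_Suc)
    show "coord (chain 2) (\<phi> (br x (chain 2))) = coord (chain 2) (br (\<phi> x) (\<phi> (chain 2)))"
      using two by (simp add: br_chain phi.neg coords)
  next
    fix k assume k: "2 \<le> k" "k < n"
    then show "coord (chain (Suc k)) (\<phi> (br x (chain 2))) = coord (chain (Suc k)) (br (\<phi> x) (\<phi> (chain 2)))"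
      using two by (simp add: br_chain phi.neg coords exp_coeff_0 Suc_diff_le numeral_2_eq_2)
  qed (use two in \<open>simp_all add: br_chain phi.neg coords\<close>)
  have x_x: "\<phi> (br x x) = br (\<phi> x) (\<phi> x)"
  proof (rule coord_eqI_Suc)
    show "coord (chain 2) (\<phi> (br x x)) = coord (chain 2) (br (\<phi> x) (\<phi> x))"
      by (simp add: br_chain phi.zero coords)
  next
    fix k assume k: "2 \<le> k" "k < n"
    \<comment> \<open>The image of \<open>x\<close> has coordinate \<open>\<beta>\<close> at
      \<open>chain 2\<close>, so the vanishing of its square at position \<open>k + 1\<close> is
      \<open>exp_coeff_Suc\<close> with index \<open>k - 1\<close>.\<close>
    then obtain d where d: "k = Suc d" by (cases k) auto
    show "coord (chain (Suc k)) (\<phi> (br x x)) = coord (chain (Suc k)) (br (\<phi> x) (\<phi> x))"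
      using k two E1 exp_coeff_Suc[of \<beta> d, unfolded mult.commute[of \<beta>]]
      by (simp add: br_chain phi.zero coords d)
  qed (simp_all add: br_chain phi.zero coords)
  have right_y: "br w y = smul (coord (e 2) w) (e 2)" for w
    by (rule coord_eqI_Suc) (use two in \<open>simp_all add: coord_br coord_scale coord_chain\<close>)
  have right_0: "br w (\<phi> (chain i)) = 0" if "i \<in> {2..n}" "i \<noteq> 2" for i w
    using that two by (intro br_right_eq_0) (auto simp: c)
  have right_e2: "br w (\<phi> (e 2)) = 0" for w
    using two by (intro br_right_eq_0) (auto simp: c)
  have e2_left: "br (\<phi> (e 2)) (\<phi> b) = 0" if "b = chain 2 \<or> b = x" for b
    by (rule coord_eqI_Suc) (use that two in \<open>auto simp: coords\<close>)
  have y_left: "br y (\<phi> b) = 0" if "b = chain 2 \<or> b = x" for b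
    by (rule coord_eqI_Suc) (use that two in \<open>auto simp: coords coord_chain\<close>)
  have e2: "\<phi> (e 2) = smul \<gamma> (e 2)" using form by (simp add: automorphism_form_def)
  show ?thesis
  proof (rule bilinear_ext[where S = "chain ` {2..n} \<union> {e 2, x, y}" and t = smul
        and F = "\<lambda>u v. \<phi> (br u v)" and G = "\<lambda>u v. br (\<phi> u) (\<phi> v)"])
    fix a b assume a: "a \<in> chain ` {2..n} \<union> {e 2, x, y}" and b: "b \<in> chain ` {2..n} \<union> {e 2, x, y}"
    consider "b = chain 2" | "b = x" | "b = y" | "b = e 2" | j where "b = chain j" "j \<in> {2..n}" "j \<noteq> 2"
      using b by blast
    then show "\<phi> (br a b) = br (\<phi> a) (\<phi> b)"
    proof cases
      case 1
      then show ?thesis using a chain_chain2 x_chain2 e2_left y_left two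
        by (auto simp: br_chain phi.zero c)
    next
      case 2
      then show ?thesis using a chain_x x_x e2_left y_left
        by (auto simp: br_chain phi.zero c)
    next
      case 3
      then show ?thesis using a
        by (auto simp: br_chain phi.zero phi.scale c(13) right_y c coord_chain coord_scale e2)
    next
      case 4
      then show ?thesis using a by (auto simp: br_chain phi.zero right_e2)
    next
      case 5
      then show ?thesis using a by (auto simp: br_chain phi.zero right_0)
    qed
  next
    show "span (chain ` {2..n} \<union> {e 2, x, y}) = UNIV"
      unfolding chain_basis by (rule basis_span)
  qed (use Vector_Spaces.linear_compose[OF linear_left lin]
      Vector_Spaces.linear_compose[OF linear_right lin]
      Vector_Spaces.linear_compose[OF lin linear_left]
      Vector_Spaces.linear_compose[OF lin linear_right] vector_space_axioms
      in \<open>simp_all add: o_def\<close>)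
qed

text \<open>In finite dimension surjectivity gives bijectivity, and it follows by solving the
  triangular system for the basis vectors.\<close>

lemma automorphism_form_imp_automorphism:
  assumes lin: "Vector_Spaces.linear smul smul \<phi>" and form: "automorphism_form \<alpha> \<beta> \<gamma> \<phi>"
    and nz: "\<alpha> * \<gamma> \<noteq> 0"
  shows "leibniz_automorphism smul br \<phi>"
proof -
  interpret phi: Vector_Spaces.linear smul smul \<phi> by (fact lin)
  interpret finite_dimensional_vector_space smul "e ` {1..n} \<union> {x, y}"
    by unfold_locales (use basis_independent basis_span in simp_all)
  have sub: "subspace (range \<phi>)" by (rule phi.subspace_image) simp
  have divide: "v \<in> range \<phi>" if "smul a v \<in> range \<phi>" "a \<noteq> 0" for a v
    using subspace_scale[OF sub that(1), of "inverse a"] that(2) by simp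
  have chain_in: "chain i \<in> range \<phi>" if "i \<in> {2..n}" for i
    using that
  \<comment> \<open>Downward from \<open>chain n\<close>: the later terms in the image of
    \<open>chain i\<close> already lie in the range, and the diagonal coefficient is a power of
    \<open>\<alpha>\<close>, hence invertible.\<close>
  proof (induction "n - i" arbitrary: i rule: less_induct)
    case less
    let ?a = "\<lambda>j. \<alpha> ^ (i - 1) * exp_coeff \<beta> (j - i)"
    have "\<phi> (chain i) = (\<Sum>j=i..n. smul (?a j) (chain j))"
      using form less.prems by (simp add: automorphism_form_def)
    also have "\<dots> = smul (\<alpha> ^ (i - 1)) (chain i) + (\<Sum>j=Suc i..n. smul (?a j) (chain j))"
      using less.prems by (subst sum.atLeast_Suc_atMost) (simp_all add: exp_coeff_0)
    finally have "smul (\<alpha> ^ (i - 1)) (chain i) = \<phi> (chain i) - (\<Sum>j=Suc i..n. smul (?a j) (chain j))"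
      by simp
    also have "\<dots> \<in> range \<phi>"
      using less by (intro subspace_diff[OF sub] subspace_sum[OF sub] subspace_scale[OF sub]) auto
    finally show ?case by (rule divide) (use nz in simp)
  qed
  have "smul \<gamma> (e 2) \<in> range \<phi>" "\<phi> x \<in> range \<phi>" "y \<in> range \<phi>"
    using form unfolding automorphism_form_def by (metis rangeI)+
  then have e2_in: "e 2 \<in> range \<phi>" and y_in: "y \<in> range \<phi>" using divide nz by auto
  have "x = \<phi> x - (\<Sum>j=2..n. smul (- exp_coeff \<beta> (j - 1)) (chain j))"
    using form by (simp add: automorphism_form_def)
  also have "\<dots> \<in> range \<phi>"
    using chain_in by (intro subspace_diff[OF sub] subspace_sum[OF sub] subspace_scale[OF sub]) auto
  finally have "chain ` {2..n} \<union> {e 2, x, y} \<subseteq> range \<phi>"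
    using chain_in e2_in y_in by blast
  then have surj: "surj \<phi>"
    using span_minimal[OF _ sub] basis_span unfolding chain_basis by blast
  then have "inj \<phi>" by (rule linear_surj_imp_inj[OF lin])
  with surj show ?thesis
    unfolding leibniz_automorphism_def using lin automorphism_form_mult[OF lin form]
    by (simp add: bij_def)
qed

section \<open>Automorphisms have the stated form\<close>

lemma automorphism_imp_automorphism_form:
  assumes aut: "leibniz_automorphism smul br \<phi>"
  shows "\<exists>\<alpha> \<beta> \<gamma>. \<alpha> * \<gamma> \<noteq> 0 \<and> automorphism_form \<alpha> \<beta> \<gamma> \<phi>"
proof -
  have lin: "Vector_Spaces.linear smul smul \<phi>" and inj: "inj \<phi>"
    and mult: "\<phi> (br u v) = br (\<phi> u) (\<phi> v)" for u v
    using aut by (auto simp: leibniz_automorphism_def bij_def)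
  interpret phi: Vector_Spaces.linear smul smul \<phi> by (fact lin)
  have two: "2 \<in> {2..n}" using n_ge_3 by simp
  have nonzero: "\<phi> v \<noteq> 0" if "coord b v \<noteq> 0" for b v
    using that inj phi.zero by (metis coord_zero injD)
  \<comment> \<open>Each relation between the images is read at one coordinate, in an order in which
    the factor to be cancelled is already known to be nonzero: first \<open>\<alpha>\<close>, then
    the \<open>x\<close>-coordinate of \<open>W\<close>, then \<open>\<gamma>\<close>, and from
    these the rest.\<close>
  define A W G Y where "A = \<phi> (chain 2)" and "W = \<phi> x" and "G = \<phi> (e 2)" and "Y = \<phi> y"
  define \<alpha> \<beta> \<gamma> where "\<alpha> = coord (chain 2) A" and "\<beta> = coord (chain 2) W" and "\<gamma> = coord (e 2) G"
  have A_W: "br A W = A" and W_A: "br W A = - A" and A_Y: "br A Y = 0"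
    and G_Y: "br G Y = G" and G_W: "br G W = 0" and W_G: "br W G = 0"
    and W_W: "br W W = 0" and W_Y: "br W Y = 0" and Y_W: "br Y W = 0" and Y_Y: "br Y Y = 0"
    unfolding A_def W_def G_def Y_def mult[symmetric] using two
    by (simp_all add: br_chain phi.zero phi.neg)
  \<comment> \<open>\<open>A\<close> and \<open>G\<close> are themselves products, and products have
    no \<open>x\<close>- or \<open>y\<close>-coordinate.\<close>
  have xA: "coord x A = 0" and yA: "coord y A = 0"
    using coord_br(4,5)[of A W] by (simp_all add: A_W)
  have xG: "coord x G = 0" and yG: "coord y G = 0"
    using coord_br(4,5)[of G Y] by (simp_all add: G_Y)
  have zA: "coord (e 2) A = 0"
    using coord_br(2)[of W A] yA by (simp add: W_A coord_uminus)
  \<comment> \<open>Otherwise right multiplication by \<open>A\<close> would vanish, yet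
    \<open>[A, A]\<close> is the image of \<open>chain 3\<close>, which is nonzero by
    injectivity.\<close>
  have "\<alpha> \<noteq> 0"
  proof
    assume a: "\<alpha> = 0"
    have "br A A = 0"
      using a xA yA by (intro br_right_eq_0) (simp_all add: \<alpha>_def)
    moreover have "br A A = \<phi> (chain 3)"
      unfolding A_def mult[symmetric] using n_ge_3 by (simp add: br_chain)
    moreover have "\<phi> (chain 3) \<noteq> 0"
      using n_ge_3 by (intro nonzero[of "chain 3"]) (simp add: coord_chain)
    ultimately show False by simp
  qed
  \<comment> \<open>At \<open>chain 2\<close>, \<open>[W, A] = -A\<close> says that
    \<open>\<alpha>\<close> times this coordinate is \<open>\<alpha>\<close>.\<close>
  have xW: "coord x W = 1"
    using coord_br(1)[of W A] xA \<open>\<alpha> \<noteq> 0\<close> by (simp add: W_A coord_uminus \<alpha>_def)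
  have chain2G: "coord (chain 2) G = 0"
    using coord_br(1)[of W G] xG xW by (simp add: W_G coord_zero)
  \<comment> \<open>Once the coordinate at \<open>k\<close> vanishes, \<open>[G, W] = 0\<close>
    leaves \<open>k\<close> times the next one, and \<open>k \<ge> 2\<close> can be
    cancelled.\<close>
  have chainG: "coord (chain m) G = 0" if "2 \<le> m" "m \<le> n" for m
    using that
  proof (induction m rule: dec_induct)
    case (step k)
    then show ?case using coord_br(3)[of k G W] xW by (simp add: G_W coord_zero)
  qed (rule chain2G)
  have G: "G = smul \<gamma> (e 2)"
    by (rule coord_eqI) (simp_all add: chainG xG yG coord_scale coord_chain \<gamma>_def)
  have "G \<noteq> 0"
    unfolding G_def by (intro nonzero[of "e 2"]) (simp add: coord_chain)
  then have "\<gamma> \<noteq> 0" using G by auto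
  have yW: "coord y W = 0"
    using coord_br(2)[of G W] \<open>\<gamma> \<noteq> 0\<close> by (simp add: G_W coord_zero \<gamma>_def)
  have yY: "coord y Y = 1"
    using coord_br(2)[of G Y] \<open>\<gamma> \<noteq> 0\<close> by (simp add: G_Y \<gamma>_def)
  have xY: "coord x Y = 0"
    using coord_br(1)[of A Y] xA \<open>\<alpha> \<noteq> 0\<close> by (simp add: A_Y coord_zero \<alpha>_def)
  have zW: "coord (e 2) W = 0"
    using coord_br(2)[of W Y] yY by (simp add: W_Y coord_zero)
  have zY: "coord (e 2) Y = 0"
    using coord_br(2)[of Y Y] yY by (simp add: Y_Y coord_zero)
  have chainY: "coord (chain m) Y = 0" if "2 \<le> m" "m \<le> n" for m
    using that
  proof (induction m rule: dec_induct)
    case base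
    then show ?case using coord_br(1)[of Y W] xY xW by (simp add: Y_W coord_zero)
  next
    case (step k)
    then show ?case using coord_br(3)[of k Y W] xW by (simp add: Y_W coord_zero)
  qed
  have Y: "Y = y"
    by (rule coord_eqI) (simp_all add: chainY xY yY zY coord_chain)
  \<comment> \<open>With \<open>w_k\<close> the coordinate at \<open>chain k\<close>,
    \<open>[W, W] = 0\<close> gives \<open>\<beta> w_k + k w_(k+1) = 0\<close>, which is the
    recursion of \<open>exp_coeff\<close> at index \<open>k - 1\<close>.\<close>
  have chainW: "coord (chain m) W = - exp_coeff \<beta> (m - 1)" if "2 \<le> m" "m \<le> n" for m
    using that
  proof (induction m rule: dec_induct)
    case base
    then show ?case by (simp add: \<beta>_def exp_coeff_def)
  next
    case (step k)
    then obtain d where d: "k = Suc d" by (cases k) auto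
    have "of_nat k * coord (chain (Suc k)) W = \<beta> * exp_coeff \<beta> d"
      using coord_br(3)[of k W W] xW step by (simp add: W_W coord_zero d \<beta>_def[symmetric] algebra_simps)
    also have "\<dots> = of_nat k * (- exp_coeff \<beta> k)"
      using exp_coeff_Suc[of \<beta> d] by (simp add: d del: of_nat_Suc)
    finally have eq: "of_nat k * coord (chain (Suc k)) W = of_nat k * (- exp_coeff \<beta> k)" .
    have "(of_nat k :: complex) \<noteq> 0" unfolding d by (simp del: of_nat_Suc)
    from mult_left_cancel[OF this, THEN iffD1, OF eq] show ?case by (simp only: diff_Suc_1)
  qed
  have W: "W = (\<Sum>j=2..n. smul (- exp_coeff \<beta> (j - 1)) (chain j)) + x"
    by (rule coord_eqI)
      (simp_all add: chainW xW yW zW coord_add coord_lincomb coord_chain del: scale_minus_left)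
  have chainA: "coord (chain m) A = \<alpha> * exp_coeff \<beta> (m - 2)" if "2 \<le> m" "m \<le> n" for m
    using that
  proof (induction m rule: dec_induct)
    case base
    then show ?case by (simp add: \<alpha>_def exp_coeff_def)
  next
    case (step k)
    \<comment> \<open>The unknown occurs on both sides of \<open>[A, W] = A\<close>, so its factor
      is \<open>k - 1\<close> instead of \<open>k\<close>; with \<open>k = d + 2\<close> this is
      \<open>Suc d\<close>, which is nonzero.\<close>
    then obtain d where d: "k = d + 2" by (metis add.commute le_Suc_ex)
    have "coord (chain (Suc k)) A = \<alpha> * exp_coeff \<beta> d * \<beta> + of_nat k * coord (chain (Suc k)) A"
      using coord_br(3)[of k A W] xW step by (simp add: A_W d \<beta>_def)
    then have "of_nat (Suc d) * coord (chain (Suc k)) A = \<alpha> * (- \<beta> * exp_coeff \<beta> d)"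
      by (simp add: d algebra_simps eq_neg_iff_add_eq_0)
    also have "\<dots> = of_nat (Suc d) * (\<alpha> * exp_coeff \<beta> (Suc d))"
      by (simp add: exp_coeff_Suc del: of_nat_Suc)
    finally show ?case by (simp add: d del: of_nat_Suc)
  qed
  \<comment> \<open>As \<open>chain (k + 1) = [chain k, chain 2]\<close>, each image is the previous
    one multiplied on the right by \<open>A\<close>. Since \<open>A\<close> has no \<open>x\<close>-
    or \<open>y\<close>-coordinate, on the span of the chain this is \<open>\<alpha>\<close> times
    the shift.\<close>
  have chain_image: "\<phi> (chain i) = (\<Sum>j=i..n. smul (\<alpha> ^ (i - 1) * exp_coeff \<beta> (j - i)) (chain j))"
    if "2 \<le> i" "i \<le> n" for i
    using that
  proof (induction i rule: dec_induct)
    case base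
    show ?case unfolding A_def[symmetric]
      by (rule coord_eqI) (simp_all add: chainA xA yA zA coord_lincomb)
  next
    case (step k)
    let ?S = "\<lambda>i. \<Sum>j=i..n. smul (\<alpha> ^ (i - 1) * exp_coeff \<beta> (j - i)) (chain j)"
    have S: "\<phi> (chain k) = ?S k" using step by simp
    have "\<phi> (chain (Suc k)) = br (?S k) A"
      unfolding A_def S[symmetric] mult[symmetric] using step two by (simp add: br_chain)
    also have "\<dots> = ?S (Suc k)"
    proof (rule coord_eqI_Suc)
      show "coord (chain 2) (br (?S k) A) = coord (chain 2) (?S (Suc k))"
        using step.hyps two xA by (simp add: coord_br coord_lincomb)
    next
      fix l assume l: "2 \<le> l" "l < n"
      have "coord (chain (Suc l)) (br (?S k) A) = (if k \<le> l then \<alpha> ^ (k - 1) * exp_coeff \<beta> (l - k) * \<alpha> else 0)"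
        using step.hyps l xA by (simp add: coord_br coord_lincomb \<alpha>_def)
      also have "\<dots> = coord (chain (Suc l)) (?S (Suc k))"
        using step.hyps l by (cases k) (simp_all add: coord_lincomb)
      finally show "coord (chain (Suc l)) (br (?S k) A) = coord (chain (Suc l)) (?S (Suc k))" .
    qed (use step.hyps yA in \<open>simp_all add: coord_br coord_lincomb\<close>)
    finally show ?case .
  qed
  have "automorphism_form \<alpha> \<beta> \<gamma> \<phi>"
    unfolding automorphism_form_def using chain_image G W Y
    by (simp add: G_def W_def Y_def)
  with \<open>\<alpha> \<noteq> 0\<close> \<open>\<gamma> \<noteq> 0\<close> show ?thesis by (metis mult_eq_0_iff)
qed

section \<open>Return to the original basis\<close>

text \<open>The \<open>chain 2\<close> terms are split off as multiples of \<open>e 1\<close>, and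
  the signs agree because \<open>(-1)^(j-2) = (-1)^j\<close> in the image of \<open>e 1\<close> and
  \<open>-(-1)^(j-1) = (-1)^j\<close> in that of \<open>x\<close>.\<close>

lemma automorphism_form_iff:
  "automorphism_form \<alpha> \<beta> \<gamma> \<phi> \<longleftrightarrow>
      \<phi> (e 1) = smul \<alpha> (e 1) + (\<Sum>i=3..n. smul ((-1)^i * \<alpha> * \<beta>^(i-2) / fact (i-2)) (e i)) \<and>
      \<phi> (e 2) = smul \<gamma> (e 2) \<and>
      (\<forall>i\<in>{3..n}. \<phi> (e i) =
        (\<Sum>j=i..n. smul ((-1)^(j-i) * \<alpha>^(i-1) * \<beta>^(j-i) / fact (j-i)) (e j))) \<and>
      \<phi> x = smul \<beta> (e 1) + (\<Sum>i=3..n. smul ((-1)^i * \<beta>^(i-1) / fact (i-1)) (e i)) + x \<and>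
      \<phi> y = y"
proof -
  have atLeast2: "{2..n} = insert 2 {3..n}" using n_ge_3 by auto
  have chain: "chain 2 = e 1" "\<And>i. 3 \<le> i \<Longrightarrow> chain i = e i" by (auto simp: chain_def)
  have "(\<Sum>j=2..n. smul (\<alpha> ^ (2 - 1) * exp_coeff \<beta> (j - 2)) (chain j))
      = smul \<alpha> (e 1) + (\<Sum>i=3..n. smul ((-1)^i * \<alpha> * \<beta>^(i-2) / fact (i-2)) (e i))"
  proof -
    have "smul (\<alpha> * exp_coeff \<beta> (j - 2)) (chain j)
        = smul ((-1)^j * \<alpha> * \<beta>^(j-2) / fact (j-2)) (e j)" if "j \<in> {3..n}" for j
    proof -
      have "2 \<le> j" using that by simp
      then obtain d where "j = 2 + d" using le_Suc_ex by blast
      then show ?thesis using that by (simp add: chain exp_coeff_def power_minus[of \<beta>] mult_ac)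
    qed
    then have "(\<Sum>j=3..n. smul (\<alpha> * exp_coeff \<beta> (j - 2)) (chain j))
        = (\<Sum>i=3..n. smul ((-1)^i * \<alpha> * \<beta>^(i-2) / fact (i-2)) (e i))"
      by (intro sum.cong refl)
    then show ?thesis by (simp add: atLeast2 chain exp_coeff_0)
  qed
  moreover have "(\<Sum>j=i..n. smul (\<alpha> ^ (i - 1) * exp_coeff \<beta> (j - i)) (chain j))
      = (\<Sum>j=i..n. smul ((-1)^(j-i) * \<alpha>^(i-1) * \<beta>^(j-i) / fact (j-i)) (e j))" if "3 \<le> i" for i
    using that by (intro sum.cong) (simp_all add: chain exp_coeff_def power_minus[of \<beta>] mult_ac)
  moreover have "(\<Sum>j=2..n. smul (- exp_coeff \<beta> (j - 1)) (chain j))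
      = smul \<beta> (e 1) + (\<Sum>i=3..n. smul ((-1)^i * \<beta>^(i-1) / fact (i-1)) (e i))"
  proof -
    have "smul (- exp_coeff \<beta> (j - 1)) (chain j)
        = smul ((-1)^j * \<beta>^(j-1) / fact (j-1)) (e j)" if "j \<in> {3..n}" for j
      using that by (cases j) (simp_all add: chain exp_coeff_def power_minus[of \<beta>] del: scale_minus_left)
    then have "(\<Sum>j=3..n. smul (- exp_coeff \<beta> (j - 1)) (chain j))
        = (\<Sum>i=3..n. smul ((-1)^i * \<beta>^(i-1) / fact (i-1)) (e i))"
      by (intro sum.cong refl)
    moreover have "- exp_coeff \<beta> (2 - 1) = \<beta>" by (simp add: exp_coeff_def)
    ultimately show ?thesis by (simp add: atLeast2 chain del: scale_minus_left)
  qed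
  moreover have "(\<forall>i\<in>{2..n}. Q i) \<longleftrightarrow> Q 2 \<and> (\<forall>i\<in>{3..n}. Q i)" for Q
    using atLeast2 by auto
  ultimately show ?thesis
    unfolding automorphism_form_def by (simp add: chain conj_left_commute del: scale_minus_left)
qed

end

theorem theorem0p3p4:
  fixes smul :: "complex \<Rightarrow> 'v::ab_group_add \<Rightarrow> 'v" (infixr "\<cdot>" 75)
    and br :: "'v \<Rightarrow> 'v \<Rightarrow> 'v"
    and n :: nat
    and e :: "nat \<Rightarrow> 'v"
    and x y :: 'v
    and \<phi> :: "'v \<Rightarrow> 'v"
  assumes "3 \<le> n"
    and "R3_algebra smul br n e x y"
    and "Vector_Spaces.linear smul smul \<phi>"
  shows "leibniz_automorphism smul br \<phi> \<longleftrightarrow>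
    (\<exists>\<alpha> \<beta> \<gamma> :: complex. \<alpha> * \<gamma> \<noteq> 0 \<and>
      \<phi> (e 1) = \<alpha> \<cdot> e 1 + (\<Sum>i=3..n. ((-1)^i * \<alpha> * \<beta>^(i-2) / fact (i-2)) \<cdot> e i) \<and>
      \<phi> (e 2) = \<gamma> \<cdot> e 2 \<and>
      (\<forall>i\<in>{3..n}. \<phi> (e i) =
        (\<Sum>j=i..n. ((-1)^(j-i) * \<alpha>^(i-1) * \<beta>^(j-i) / fact (j-i)) \<cdot> e j)) \<and>
      \<phi> x = \<beta> \<cdot> e 1 + (\<Sum>i=3..n. ((-1)^i * \<beta>^(i-1) / fact (i-1)) \<cdot> e i) + x \<and>
      \<phi> y = y)"
proof -
  interpret R3_algebra_ge_3 smul br n e x y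
    using assms(1,2) by (simp add: R3_algebra_ge_3_def R3_algebra_ge_3_axioms_def)
  show ?thesis
    unfolding automorphism_form_iff[symmetric]
    using automorphism_form_imp_automorphism[OF assms(3)] automorphism_imp_automorphism_form by blast
qed

end
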